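(* Let $f(X)$ be a polynomial with real coefficients of degree $n\ge 3$ with $f(0)\neq 0$, and assume that its reciprocal $\tilde f(X)=X^nf(\frac1X)$ has no roots in the sector $S_{\tilde v,\frac{\pi}{n}}$ for some positive real number $\tilde v$. Then $f$ has no zeros in the open lens-shaped region $L_{\tilde v,\frac{\pi}{n}}$ consisting of all complex numbers $x+iy$ ($x,y\in\mathbb{R}$) with $$x\in\left(0,\frac{1}{\tilde v}\right),\qquad |y|<\frac{-1}{2\tilde v\tan\frac{\pi}{n}}+\sqrt{\frac{1}{4\tilde v^2\sin^2\frac{\pi}{n}}-\left(x-\frac{1}{2\tilde v}\right)^2}.$$
   Context: For real numbers $v,\theta$ with $0<\theta<\pi$, define the open sector $S_{v,\theta}=\{z=v+\rho e^{i\varphi}\in\mathbb{C}:\rho>0,\ |\varphi|<\theta\}$ (with $\varphi$ real). *)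

theory Defs
  imports Complex_Main "HOL-Computational_Algebra.Polynomial"
begin

text \<open>
  The open sector \<open>S\<^bsub>v,\<theta>\<^esub>\<close> with apex \<open>v\<close> and half-angle \<open>\<theta>\<close>, intended for \<open>0 < \<theta> < \<pi>\<close>;
  \<^const>\<open>rcis\<close>~\<open>\<rho> \<phi>\<close> is \<open>\<rho> e\<^sup>i\<^sup>\<phi>\<close>.
\<close>
definition sector :: "real \<Rightarrow> real \<Rightarrow> complex set" where
  "sector v \<theta> = {complex_of_real v + rcis \<rho> \<phi> | \<rho> \<phi>. \<rho> > 0 \<and> \<bar>\<phi>\<bar> < \<theta>}"

text \<open>
  The open lens \<open>L\<^bsub>v,\<theta>\<^esub>\<close>, intended for \<open>v > 0\<close> and \<open>0 < \<theta> < \<pi>/2\<close>. The radicand is positive for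
  \<open>0 < x < 1/v\<close>, so the value of \<^const>\<open>sqrt\<close> at negative arguments plays no role.
\<close>
definition lens :: "real \<Rightarrow> real \<Rightarrow> complex set" where
  "lens v \<theta> = {Complex x y | x y.
     x \<in> {0<..<1 / v} \<and>
     \<bar>y\<bar> < - 1 / (2 * v * tan \<theta>)
            + sqrt (1 / (4 * v\<^sup>2 * (sin \<theta>)\<^sup>2) - (x - 1 / (2 * v))\<^sup>2)}"

text \<open>
  The reciprocal \<open>X\<^sup>n f(1/X)\<close> of a polynomial \<open>f\<close> of degree \<open>n\<close> is \<^const>\<open>reflect_poly\<close>~\<open>f\<close>
  (see \<open>poly_reflect_poly_nz\<close>). Complex roots of a real polynomial are taken after mapping
  its coefficients into the complex numbers.
\<close>
definition complex_roots :: "real poly \<Rightarrow> complex set" where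
  "complex_roots p = {z. poly (map_poly complex_of_real p) z = 0}"

end

theory Submission
  imports Defs
begin

text \<open>
  Inversion \<open>z \<mapsto> 1/z\<close> maps the lens into the sector: the lens is bounded by two circular arcs through
  \<open>0\<close> and \<open>1/v\<close>, which become the two rays of the sector. Concretely, both \<open>z \<in> L\<close> and
  \<open>1/z \<in> S\<close> amount to \<open>\<bar>y\<bar> cot \<theta> < x - v (x\<^sup>2 + y\<^sup>2)\<close> for \<open>z = x + iy\<close>. A zero of \<open>f\<close> in the lens would
  therefore give a zero of the reciprocal polynomial in the sector.
\<close>

text \<open>\<open>of_real\<close> sends only 0 to 0, so it preserves the degree and hence the order
  in which coefficients are reversed.\<close>

lemma reflect_poly_map_poly_of_real:
  "reflect_poly (map_poly of_real p) = map_poly (of_real :: real \<Rightarrow> complex) (reflect_poly p)"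
  by (rule poly_eqI) (simp add: coeff_reflect_poly coeff_map_poly degree_map_poly)

lemma inverse_mem_complex_roots_reflect_poly:
  assumes "z \<in> complex_roots f" and "z \<noteq> 0"
  shows "inverse z \<in> complex_roots (reflect_poly f)"
  using assms
  by (simp add: complex_roots_def reflect_poly_map_poly_of_real [symmetric] poly_reflect_poly_nz)

text \<open>An acute half-angle confines the sector to \<open>Re w > v\<close>, so the argument of
  \<open>w - v\<close> is an \<open>arctan\<close>, and monotonicity of \<open>arctan\<close> turns
  the slope bound into an angle bound.\<close>

lemma sectorI:
  assumes "0 < \<theta>" and "\<theta> < pi / 2"
    and "\<bar>Im w\<bar> < (Re w - v) * tan \<theta>"
  shows "w \<in> sector v \<theta>"
proof -
  define a b where "a = Re w - v" and "b = Im w"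
  have t: "tan \<theta> > 0"
    using assms by (simp add: tan_gt_zero)
  have a: "a > 0"
    using assms(3) t unfolding a_def by (smt (verit) mult_nonpos_nonneg)
  \<comment> \<open>This is the modulus of \<open>w - v\<close>, factored to fit the formulas for
    \<open>cos\<close> and \<open>sin\<close> of \<open>arctan\<close>.\<close>
  define \<rho> where "\<rho> = a * sqrt (1 + (b / a)\<^sup>2)"
  define \<phi> where "\<phi> = arctan (b / a)"
  have pos: "1 + (b / a)\<^sup>2 > 0"
    by (smt (verit) zero_le_power2)
  have \<rho>: "\<rho> > 0"
    using a pos by (simp add: \<rho>_def)
  have "\<bar>b / a\<bar> < tan \<theta>"
    using assms(3) a by (simp add: a_def b_def field_simps)
  moreover have "arctan (tan \<theta>) = \<theta>"
    using assms by (intro arctan_tan) auto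
  ultimately have "\<phi> < \<theta>" and "- \<phi> < \<theta>"
    unfolding \<phi>_def by (metis abs_less_iff arctan_less_iff arctan_minus)+
  then have \<phi>: "\<bar>\<phi>\<bar> < \<theta>"
    by simp
  have "\<rho> * cos \<phi> = a" and "\<rho> * sin \<phi> = b"
    using a pos by (simp_all add: \<rho>_def \<phi>_def cos_arctan sin_arctan)
  then have "w = complex_of_real v + rcis \<rho> \<phi>"
    by (simp add: complex_eq_iff a_def b_def)
  then show ?thesis
    using \<rho> \<phi> unfolding sector_def by blast
qed

lemma inverse_lens_mem_sector:
  assumes "0 < \<theta>" and "\<theta> < pi / 2" and "v > 0" and "z \<in> lens v \<theta>"
  shows "inverse z \<in> sector v \<theta>"
proof (rule sectorI [OF assms(1,2)])
  obtain x y where z: "z = Complex x y" and x: "x > 0"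
    and y: "\<bar>y\<bar> < - 1 / (2 * v * tan \<theta>)
      + sqrt (1 / (4 * v\<^sup>2 * (sin \<theta>)\<^sup>2) - (x - 1 / (2 * v))\<^sup>2)"
    using assms(4) unfolding lens_def by auto
  define c where "c = 1 / tan \<theta>"
  have t: "tan \<theta> > 0" and s: "sin \<theta> > 0"
    using assms by (simp_all add: tan_gt_zero sin_gt_zero)
  then have c: "c > 0"
    by (simp add: c_def)
  have csc: "1 / (sin \<theta>)\<^sup>2 = 1 + c\<^sup>2"
    using s by (simp add: c_def tan_def field_simps)
  \<comment> \<open>The root is isolated; as the left side is nonnegative, both sides can be
    squared.\<close>
  have "\<bar>y\<bar> + c / (2 * v) < sqrt ((1 + c\<^sup>2) / (4 * v\<^sup>2) - (x - 1 / (2 * v))\<^sup>2)"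
    using y unfolding csc [symmetric] by (simp add: c_def field_simps)
  moreover have "\<bar>y\<bar> + c / (2 * v) \<ge> 0"
    using c assms(3) by simp
  ultimately have "(\<bar>y\<bar> + c / (2 * v))\<^sup>2 < (1 + c\<^sup>2) / (4 * v\<^sup>2) - (x - 1 / (2 * v))\<^sup>2"
    by (smt (verit) real_less_rsqrt real_sqrt_less_iff real_sqrt_abs)
  \<comment> \<open>After expansion \<open>c\<^sup>2 / (4 * v\<^sup>2)\<close> cancels between the
    sides and \<open>1 / (4 * v\<^sup>2)\<close> within the right one.\<close>
  then have "y\<^sup>2 + \<bar>y\<bar> * c / v < x / v - x\<^sup>2"
    using assms(3) by (simp add: power2_sum power2_diff power_divide power_mult_distrib add_divide_distrib)
  then have "v * (y\<^sup>2 + \<bar>y\<bar> * c / v) < v * (x / v - x\<^sup>2)"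
    using assms(3) by simp
  then have "\<bar>y\<bar> * c < x - v * (x\<^sup>2 + y\<^sup>2)"
    using assms(3) by (simp add: algebra_simps)
  then have main: "\<bar>y\<bar> < (x - v * (x\<^sup>2 + y\<^sup>2)) * tan \<theta>"
    using t by (simp add: c_def field_simps)
  have r: "x\<^sup>2 + y\<^sup>2 > 0"
    using x by (simp add: add_pos_nonneg)
  \<comment> \<open>Since \<open>inverse z\<close> is the conjugate of \<open>z\<close> over
    \<open>x\<^sup>2 + y\<^sup>2\<close>, dividing \<open>main\<close> by this gives the slope
    bound.\<close>
  have "\<bar>Im (inverse z)\<bar> = \<bar>y\<bar> / (x\<^sup>2 + y\<^sup>2)"
    using r by (simp add: z)
  also have "\<dots> < (x - v * (x\<^sup>2 + y\<^sup>2)) * tan \<theta> / (x\<^sup>2 + y\<^sup>2)"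
    using main r by (simp add: divide_strict_right_mono)
  also have "\<dots> = (Re (inverse z) - v) * tan \<theta>"
    using r x by (simp add: z diff_divide_distrib left_diff_distrib)
  finally show "\<bar>Im (inverse z)\<bar> < (Re (inverse z) - v) * tan \<theta>" .
qed

theorem lemma2p14:
  fixes f :: "real poly" and n :: nat and v :: real
  assumes "degree f = n" and "n \<ge> 3" and "poly f 0 \<noteq> 0"
    and "v > 0"
    and "complex_roots (reflect_poly f) \<inter> sector v (pi / real n) = {}"
  shows "complex_roots f \<inter> lens v (pi / real n) = {}"
proof -
  \<comment> \<open>The degree bound makes the half-angle acute.\<close>
  have \<theta>: "0 < pi / real n" "pi / real n < pi / 2"
    using assms(2) by (simp, intro divide_strict_left_mono) auto
  have False if "z \<in> complex_roots f" and "z \<in> lens v (pi / real n)" for z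
  proof -
    have "z \<noteq> 0"
      using that(2) by (auto simp: lens_def complex_eq_iff)
    then show False
      using that assms(4,5) \<theta> inverse_mem_complex_roots_reflect_poly inverse_lens_mem_sector
      by blast
  qed
  then show ?thesis
    by blast
qed

end
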